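(* Let $\alpha,\beta<\epsilon_0$, let $X_0,X_1\subseteq\mathbb{N}$ be finite and let $\star\in\mathbb{N}$ with $\star>x$ for all $x\in X_0\cup X_1$. If $X=X_0\cup X_1\cup\{\star\}$ is $(\alpha\oplus\beta)$-large, then either $X_0$ is $\alpha$-large or $X_1$ is $\beta$-large.
   Context: $\oplus$ is the natural (Hessenberg) sum of ordinals. Fundamental sequences: $\{0\}(x)=0$; for $\alpha\neq0$ write $\alpha=\delta+\omega^\gamma$ in Cantor normal form with $\omega^\gamma$ the last term; $\{\alpha\}(x)=\delta$ if $\gamma=0$, $\delta+\omega^{\gamma'}\cdot x$ if $\gamma=\gamma'+1$, $\delta+\omega^{\{\gamma\}(x)}$ if $\gamma$ is a limit. For finite $X=\{x_0<\dots<x_s\}$, $\{\alpha\}(X)=\{\cdots\{\{\alpha\}(x_0)\}(x_1)\cdots\}(x_s)$ and $X$ is $\alpha$-large iff $\{\alpha\}(X)=0$.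
   Formalization: The sets X_0 and X_1 are assumed not to contain 0; with 0 allowed the claim fails, e.g. for α=ω^ω, β=ω^2, X_0={0}, X_1={1,2,5}, ⋆=7. *)

theory Defs
  imports Main
begin

section \<open>Cantor normal forms\<close>

text \<open>
  \<open>Cnf [a\<^sub>1, \<dots>, a\<^sub>n]\<close> stands for \<open>\<omega>\<^bsup>a\<^sub>1\<^esup> + \<dots> + \<omega>\<^bsup>a\<^sub>n\<^esup>\<close>; it is a Cantor normal form when
  \<open>a\<^sub>1 \<ge> \<dots> \<ge> a\<^sub>n\<close>, hereditarily. Normal forms are compared lexicographically by their exponents.
\<close>

datatype cnf = Cnf (exps: "cnf list")

fun less_cnf' :: "cnf \<Rightarrow> cnf \<Rightarrow> bool" where
  "less_cnf' (Cnf as) (Cnf []) \<longleftrightarrow> False"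
| "less_cnf' (Cnf []) (Cnf (b # bs)) \<longleftrightarrow> True"
| "less_cnf' (Cnf (a # as)) (Cnf (b # bs)) \<longleftrightarrow>
     less_cnf' a b \<or> a = b \<and> less_cnf' (Cnf as) (Cnf bs)"

lemma less_cnf'_irrefl: "\<not> less_cnf' s s"
proof (induction s)
  case (Cnf as)
  then show ?case by (induction as) auto
qed

lemma less_cnf'_trans: "less_cnf' s t \<Longrightarrow> less_cnf' t u \<Longrightarrow> less_cnf' s u"
proof (induction s t arbitrary: u rule: less_cnf'.induct)
  case (2 b bs)
  then show ?case by (cases "(Cnf [], u)" rule: less_cnf'.cases) auto
next
  case (3 a as b bs)
  then show ?case by (cases "(Cnf (b # bs), u)" rule: less_cnf'.cases) auto
qed simp

lemma less_cnf'_total: "less_cnf' s t \<or> s = t \<or> less_cnf' t s"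
proof (induction s t rule: less_cnf'.induct)
  case (1 as)
  then show ?case by (cases as) auto
qed auto

instantiation cnf :: linorder
begin

definition less_cnf :: "cnf \<Rightarrow> cnf \<Rightarrow> bool" where
  "s < t \<longleftrightarrow> less_cnf' s t"

definition less_eq_cnf :: "cnf \<Rightarrow> cnf \<Rightarrow> bool" where
  "s \<le> t \<longleftrightarrow> less_cnf' s t \<or> s = t"

instance
  by standard
    (auto simp: less_cnf_def less_eq_cnf_def less_cnf'_irrefl
      dest: less_cnf'_trans less_cnf'_total[THEN disjE] intro: less_cnf'_trans,
      (metis less_cnf'_irrefl less_cnf'_trans less_cnf'_total)+)

end

lemma less_cnf_simps [simp]:
  "\<not> s < Cnf []"
  "Cnf [] < Cnf (b # bs)"
  "Cnf (a # as) < Cnf (b # bs) \<longleftrightarrow> a < b \<or> a = b \<and> Cnf as < Cnf bs"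
  by (cases s; simp add: less_cnf_def) (simp_all add: less_cnf_def)

lemma Cnf_Nil_le [simp]: "Cnf [] \<le> s"
  using less_cnf_simps(1) not_le by blast

lemma Cnf_append_less_iff [simp]: "Cnf (ds @ as) < Cnf (ds @ bs) \<longleftrightarrow> Cnf as < Cnf bs"
  by (induction ds) auto

fun nf :: "cnf \<Rightarrow> bool" where
  "nf (Cnf as) \<longleftrightarrow> sorted_wrt (\<ge>) as \<and> (\<forall>a \<in> set as. nf a)"


section \<open>Ordinals below \<open>\<epsilon>\<^sub>0\<close>\<close>

typedef eps0 = "{t :: cnf. nf t}"
  morphisms cnf_of Abs_eps0
  by (rule exI[of _ "Cnf []"]) simp

setup_lifting type_definition_eps0

instantiation eps0 :: linorder
begin
lift_definition less_eps0 :: "eps0 \<Rightarrow> eps0 \<Rightarrow> bool" is "(<)" .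
lift_definition less_eq_eps0 :: "eps0 \<Rightarrow> eps0 \<Rightarrow> bool" is "(\<le>)" .
instance by standard (transfer; auto)+
end

text \<open>The lexicographic order is well-founded on normal forms (though not on all of \<^typ>\<open>cnf\<close>).\<close>

abbreviation nf_less :: "cnf \<Rightarrow> cnf \<Rightarrow> bool" where
  "nf_less s t \<equiv> nf s \<and> nf t \<and> s < t"

lemma accp_nf_head:
  assumes "Wellfounded.accp nf_less a" "nf a" "nf (Cnf as)" "as \<noteq> [] \<longrightarrow> hd as \<le> a"
  shows "Wellfounded.accp nf_less (Cnf as)"
  using assms
proof (induction a arbitrary: as rule: accp.induct)
  case (accI a)
  have small: "Wellfounded.accp nf_less (Cnf bs)"
    if "nf (Cnf bs)" "bs \<noteq> [] \<longrightarrow> hd bs < a" for bs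
  proof (cases bs)
    case Nil
    then show ?thesis by (auto intro: accp.accI)
  next
    case (Cons b bs')
    then show ?thesis using that accI.IH[of b bs] accI.prems(1) by auto
  qed
  have cons: "Wellfounded.accp nf_less (Cnf (a # ts))"
    if "Wellfounded.accp nf_less (Cnf ts)" "nf (Cnf (a # ts))" for ts
    using that
  proof (induction "Cnf ts" arbitrary: ts rule: accp.induct)
    case (accI ts)
    show ?case
    proof (rule accp.accI)
      fix u assume u: "nf_less u (Cnf (a # ts))"
      obtain us where us: "u = Cnf us" by (cases u)
      show "Wellfounded.accp nf_less u"
      proof (cases "us \<noteq> [] \<and> hd us = a")
        case True
        then obtain us' where us': "us = a # us'" by (cases us) auto
        have "nf_less (Cnf us') (Cnf ts)" using u us us' by auto
        then show ?thesis using accI.hyps(2)[of us'] u us us' by simp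
      next
        case False
        then have "us \<noteq> [] \<longrightarrow> hd us < a" using u us by (cases us) auto
        then show ?thesis using small[of us] u us by simp
      qed
    qed
  qed
  show ?case using accI.prems
  proof (induction as)
    case Nil
    then show ?case by (auto intro: accp.accI)
  next
    case (Cons b bs)
    have "b \<le> a" using Cons.prems by simp
    have bs: "nf (Cnf bs)" "bs \<noteq> [] \<longrightarrow> hd bs \<le> b" using Cons.prems by auto
    have acc: "Wellfounded.accp nf_less (Cnf bs)"
      using Cons.IH accI.prems(1) bs \<open>b \<le> a\<close> by (meson order_trans)
    show ?case
    proof (cases "b = a")
      case True
      then show ?thesis using cons[OF acc] Cons.prems by simp
    next
      case False
      then have "b < a" using \<open>b \<le> a\<close> by simp
      then show ?thesis using small[of "b # bs"] Cons.prems by simp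
    qed
  qed
qed

lemma accp_nf: "nf t \<Longrightarrow> Wellfounded.accp nf_less t"
proof (induction t)
  case (Cnf as)
  show ?case
  proof (cases as)
    case Nil
    then show ?thesis by (auto intro: accp.accI)
  next
    case (Cons a as')
    then show ?thesis using Cnf accp_nf_head[of a as] by auto
  qed
qed

instance eps0 :: wellorder
proof
  fix P :: "eps0 \<Rightarrow> bool" and a :: eps0
  assume step: "\<And>x. (\<And>y. y < x \<Longrightarrow> P y) \<Longrightarrow> P x"
  have "nf t \<longrightarrow> P (Abs_eps0 t)" if "Wellfounded.accp nf_less t" for t
    using that
  proof (induction t rule: accp.induct)
    case (accI t)
    show ?case
    proof
      assume t: "nf t"
      show "P (Abs_eps0 t)"
      proof (rule step)
        fix y assume "y < Abs_eps0 t"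
        then have "nf_less (cnf_of y) t"
          using t cnf_of[of y] by (simp add: less_eps0.rep_eq Abs_eps0_inverse)
        then show "P y" using accI.IH[of "cnf_of y"] by (simp add: cnf_of_inverse)
      qed
    qed
  qed
  from this[of "cnf_of a"] show "P a"
    using cnf_of[of a] accp_nf[of "cnf_of a"] by (simp add: cnf_of_inverse)
qed

instantiation eps0 :: "{zero, one, plus}"
begin

lift_definition zero_eps0 :: eps0 is "Cnf []" by simp

lift_definition one_eps0 :: eps0 is "Cnf [Cnf []]" by simp

text \<open>
  Ordinary ordinal addition: the terms of the left summand that are smaller than the leading
  term of the right summand are absorbed.
\<close>

lift_definition plus_eps0 :: "eps0 \<Rightarrow> eps0 \<Rightarrow> eps0" is
  "\<lambda>s t. case exps t of [] \<Rightarrow> s | b # bs \<Rightarrow> Cnf (filter (\<lambda>a. b \<le> a) (exps s) @ b # bs)"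
proof -
  fix s t assume "nf s" "nf t"
  obtain as bs where "s = Cnf as" "t = Cnf bs" by (cases s; cases t)
  then show "nf (case exps t of [] \<Rightarrow> s | b # bs \<Rightarrow> Cnf (filter (\<lambda>a. b \<le> a) (exps s) @ b # bs))"
    using \<open>nf s\<close> \<open>nf t\<close>
    by (auto simp: sorted_wrt_append sorted_wrt_filter split: list.split)
      (meson order_trans)
qed

instance ..

end

lift_definition omega_pow :: "eps0 \<Rightarrow> eps0" (\<open>\<omega>\<^sup>_\<close> [1000] 999) is "\<lambda>a. Cnf [a]" by simp

text \<open>
  The Hessenberg sum: the terms of both Cantor normal forms, collected in non-increasing order.
\<close>

lift_definition natural_sum :: "eps0 \<Rightarrow> eps0 \<Rightarrow> eps0" (infixl \<open>\<oplus>\<close> 65) is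
  "\<lambda>s t. Cnf (rev (sort (exps s @ exps t)))"
proof -
  fix s t assume "nf s" "nf t"
  then show "nf (Cnf (rev (sort (exps s @ exps t))))"
    by (cases s; cases t) (auto simp: sorted_wrt_rev)
qed


section \<open>Fundamental sequences\<close>

lemma size_last_exps: "as \<noteq> [] \<Longrightarrow> size (last as) < size (Cnf as)"
  using size_list_estimation'[of "last as" as "size (last as)" size]
  by (simp add: less_Suc_eq_le)

function fund_cnf :: "cnf \<Rightarrow> nat \<Rightarrow> cnf" where
  "fund_cnf (Cnf as) x =
     (if as = [] then Cnf []
      else let \<delta> = butlast as; \<gamma> = last as in
        if exps \<gamma> = [] then Cnf \<delta>
        else if last (exps \<gamma>) = Cnf [] then Cnf (\<delta> @ replicate x (Cnf (butlast (exps \<gamma>))))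
        else Cnf (\<delta> @ [fund_cnf \<gamma> x]))"
  by pat_completeness auto
termination
  by (relation "measure (size \<circ> fst)") (use size_last_exps in auto)

declare fund_cnf.simps [simp del]

lemma Cnf_butlast_less: "as \<noteq> [] \<Longrightarrow> Cnf (butlast as) < Cnf as"
  using Cnf_append_less_iff[of "butlast as" "[]" "[last as]"] by simp

lemma fund_cnf_less: "t \<noteq> Cnf [] \<Longrightarrow> fund_cnf t x < t"
proof (induction t x rule: fund_cnf.induct)
  case (1 as x)
  then have as: "as = butlast as @ [last as]" by simp
  have repl: "Cnf (replicate x (Cnf (butlast (exps (last as))))) < Cnf [last as]"
    if "exps (last as) \<noteq> []"
    using Cnf_butlast_less[OF that] by (cases x) auto
  have rec: "Cnf [fund_cnf (last as) x] < Cnf [last as]"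
    if "exps (last as) \<noteq> []" "last (exps (last as)) \<noteq> Cnf []"
    using 1 that by (cases "last as") auto
  show ?case
    using 1(2) repl rec Cnf_append_less_iff[of "butlast as" _ "[last as]"]
      Cnf_butlast_less[of as] as
    by (auto simp: fund_cnf.simps[of as] Let_def)
qed

lemma nf_append: "nf (Cnf (as @ bs)) \<longleftrightarrow>
    nf (Cnf as) \<and> nf (Cnf bs) \<and> (\<forall>a \<in> set as. \<forall>b \<in> set bs. b \<le> a)"
  by (auto simp: sorted_wrt_append)

lemma nf_snocE:
  assumes "nf (Cnf as)" "as \<noteq> []"
  shows "nf (Cnf (butlast as))" "nf (last as)" "\<forall>a \<in> set (butlast as). last as \<le> a"
  using assms nf_append[of "butlast as" "[last as]"] by auto

lemma nf_fund_cnf: "nf t \<Longrightarrow> nf (fund_cnf t x)"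
proof (induction t x rule: fund_cnf.induct)
  case (1 as x)
  show ?case
  proof (cases "as = []")
    case True
    then show ?thesis by (simp add: fund_cnf.simps)
  next
    case False
    note as = nf_snocE[OF 1(2) False]
    obtain cs where cs: "last as = Cnf cs" by (cases "last as")
    have repl: "nf (Cnf (butlast as @ replicate x (Cnf (butlast cs))))" if "cs \<noteq> []"
    proof -
      have "Cnf (butlast cs) \<le> last as" using Cnf_butlast_less[OF that] cs by simp
      moreover have "nf (Cnf (butlast cs))" using nf_snocE(1) as(2) cs that by metis
      ultimately show ?thesis
        using as by (subst nf_append) (auto simp: sorted_wrt_iff_nth_less intro: order_trans)
    qed
    have rec: "nf (Cnf (butlast as @ [fund_cnf (last as) x]))"
      if "cs \<noteq> []" "last cs \<noteq> Cnf []"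
    proof -
      have "fund_cnf (last as) x \<le> last as" using fund_cnf_less[of "last as" x] cs that by simp
      moreover have "nf (fund_cnf (last as) x)" using 1(1) False as(2) cs that by auto
      ultimately show ?thesis using as by (subst nf_append) (auto intro: order_trans)
    qed
    show ?thesis using False as(1) cs repl rec by (simp add: fund_cnf.simps[of as] Let_def)
  qed
qed

lift_definition fund :: "eps0 \<Rightarrow> nat \<Rightarrow> eps0" is fund_cnf
  by (rule nf_fund_cnf)

text \<open>
  \<open>cnf_snoc \<delta> \<gamma>\<close>: every exponent in the Cantor normal form of \<open>\<delta>\<close> is at least \<open>\<gamma>\<close>, so that
  \<open>\<delta> + \<omega>\<^bsup>\<gamma>\<^esup>\<close> is in Cantor normal form with last term \<open>\<omega>\<^bsup>\<gamma>\<^esup>\<close>. In these terms \<^const>\<open>fund\<close> satisfies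
  the textbook recursion.
\<close>

lift_definition cnf_snoc :: "eps0 \<Rightarrow> eps0 \<Rightarrow> bool" is "\<lambda>d g. \<forall>a \<in> set (exps d). g \<le> a" .

lemma cnf_snoc_exists: "\<alpha> \<noteq> 0 \<Longrightarrow> \<exists>\<delta> \<gamma>. cnf_snoc \<delta> \<gamma> \<and> \<alpha> = \<delta> + \<omega>\<^sup>\<gamma>"
proof (transfer, goal_cases)
  case (1 t)
  then obtain as where as: "t = Cnf as" "as \<noteq> []" by (cases t) auto
  show ?case
    using nf_snocE[of as] 1 as
    by (intro bexI[of _ "Cnf (butlast as)"] bexI[of _ "last as"])
      (auto simp del: nf.simps cong: filter_cong)
qed

lemma fund_0: "fund 0 x = 0"
  by transfer (simp add: fund_cnf.simps)

lemma plus_omega_pow_cnf: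
  "cnf_snoc \<delta> \<gamma> \<Longrightarrow> cnf_of (\<delta> + \<omega>\<^sup>\<gamma>) = Cnf (exps (cnf_of \<delta>) @ [cnf_of \<gamma>])"
  by (simp add: plus_eps0.rep_eq omega_pow.rep_eq cnf_snoc.rep_eq)

lemma plus_one_cnf: "cnf_of (\<gamma> + 1) = Cnf (exps (cnf_of \<gamma>) @ [Cnf []])"
  by (simp add: plus_eps0.rep_eq one_eps0.rep_eq)

lemma fund_plus_one: "fund (\<delta> + \<omega>\<^sup>0) x = \<delta>"
proof -
  have "cnf_snoc \<delta> 0" by transfer simp
  then show ?thesis
    by (simp add: cnf_of_inject[symmetric] fund.rep_eq plus_omega_pow_cnf zero_eps0.rep_eq
        fund_cnf.simps)
qed

lemma fund_succ:
  assumes "cnf_snoc \<delta> (\<gamma> + 1)"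
  shows "fund (\<delta> + \<omega>\<^sup>(\<gamma> + 1)) x = ((\<lambda>\<eta>. \<eta> + \<omega>\<^sup>\<gamma>) ^^ x) \<delta>"
proof -
  have *: "\<gamma> < \<gamma> + 1"
    using Cnf_append_less_iff[of "exps (cnf_of \<gamma>)" "[]" "[Cnf []]"]
    by (simp add: less_eps0.rep_eq plus_one_cnf)
  then have "cnf_snoc \<delta> \<gamma>" using assms by (transfer, auto)
  then have "cnf_of (((\<lambda>\<eta>. \<eta> + \<omega>\<^sup>\<gamma>) ^^ x) \<delta>) =
      Cnf (exps (cnf_of \<delta>) @ replicate x (cnf_of \<gamma>))"
  proof (induction x)
    case (Suc x)
    then have "cnf_snoc (((\<lambda>\<eta>. \<eta> + \<omega>\<^sup>\<gamma>) ^^ x) \<delta>) \<gamma>" by (auto simp: cnf_snoc.rep_eq)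
    then show ?case
      using Suc by (simp add: plus_omega_pow_cnf replicate_append_same)
  qed simp
  then show ?thesis
    using assms
    by (simp add: cnf_of_inject[symmetric] fund.rep_eq plus_omega_pow_cnf plus_one_cnf
        fund_cnf.simps)
qed

lemma fund_limit:
  assumes "cnf_snoc \<delta> \<gamma>" "\<gamma> \<noteq> 0" "\<nexists>\<gamma>'. \<gamma> = \<gamma>' + 1"
  shows "fund (\<delta> + \<omega>\<^sup>\<gamma>) x = \<delta> + \<omega>\<^sup>(fund \<gamma> x)"
proof -
  obtain cs where cs: "cnf_of \<gamma> = Cnf cs" by (cases "cnf_of \<gamma>")
  have "cs \<noteq> []" using assms(2) cs by (simp add: cnf_of_inject[symmetric] zero_eps0.rep_eq)
  have "last cs \<noteq> Cnf []"
  proof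
    assume "last cs = Cnf []"
    have "nf (Cnf (butlast cs))" using nf_snocE(1) cnf_of[of \<gamma>] cs \<open>cs \<noteq> []\<close> by auto
    then have "cnf_of (Abs_eps0 (Cnf (butlast cs)) + 1) = cnf_of \<gamma>"
      using \<open>cs \<noteq> []\<close> \<open>last cs = Cnf []\<close> cs append_butlast_last_id[of cs]
      by (simp add: plus_one_cnf Abs_eps0_inverse del: nf.simps append_butlast_last_id)
    then show False using assms(3) by (metis cnf_of_inject)
  qed
  moreover have "cnf_snoc \<delta> (fund \<gamma> x)"
    using assms(1) fund_cnf_less[of "cnf_of \<gamma>" x] cs \<open>cs \<noteq> []\<close>
    by (auto simp: cnf_snoc.rep_eq fund.rep_eq)
  ultimately show ?thesis
    using assms(1) \<open>cs \<noteq> []\<close> cs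
    by (simp add: cnf_of_inject[symmetric] fund.rep_eq plus_omega_pow_cnf fund_cnf.simps)
qed


section \<open>Large sets\<close>

definition fund_set :: "eps0 \<Rightarrow> nat set \<Rightarrow> eps0" where
  "fund_set \<alpha> X = foldl fund \<alpha> (sorted_list_of_set X)"

definition large :: "eps0 \<Rightarrow> nat set \<Rightarrow> bool" where
  "large \<alpha> X \<longleftrightarrow> finite X \<and> fund_set \<alpha> X = 0"

text \<open>
  Splitting an \<open>\<alpha> \<oplus> \<beta>\<close>-large set into an \<open>\<alpha>\<close>-large and a \<open>\<beta>\<close>-large part fails for sets that
  may contain \<open>0\<close>: the step at \<open>0\<close> takes \<open>\<omega>\<^bsup>2\<^esup>\<close> to \<open>0\<close> but takes \<open>\<omega>\<^bsup>\<omega>\<^esup>\<close> only to \<open>1\<close>. Accordingly,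
  \<open>\<nat>\<close> has to be read as \<open>{1, 2, \<dots>}\<close> for such a splitting statement.
\<close>

lemma large_split_fails_at_0:
  defines "\<alpha> \<equiv> \<omega>\<^sup>(\<omega>\<^sup>1)" and "\<beta> \<equiv> \<omega>\<^sup>(1 + 1)"
  shows "large (\<alpha> \<oplus> \<beta>) ({0} \<union> {1, 2, 5} \<union> {7})"
    and "\<not> large \<alpha> {0}" and "\<not> large \<beta> {1, 2, 5}"
proof -
  have \<alpha>: "cnf_of \<alpha> = Cnf [Cnf [Cnf [Cnf []]]]"
    by (simp add: \<alpha>_def omega_pow.rep_eq one_eps0.rep_eq)
  have \<beta>: "cnf_of \<beta> = Cnf [Cnf [Cnf [], Cnf []]]"
    by (simp add: \<beta>_def omega_pow.rep_eq plus_one_cnf one_eps0.rep_eq)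
  have \<alpha>\<beta>: "cnf_of (\<alpha> \<oplus> \<beta>) = Cnf [Cnf [Cnf [Cnf []]], Cnf [Cnf [], Cnf []]]"
    by (simp add: natural_sum.rep_eq \<alpha> \<beta> not_le[symmetric] less_eq_cnf_def less_cnf_def)
  note defs = large_def fund_set_def cnf_of_inject[symmetric] fund.rep_eq zero_eps0.rep_eq
    fund_cnf.simps numeral_eq_Suc
  show "large (\<alpha> \<oplus> \<beta>) ({0} \<union> {1, 2, 5} \<union> {7})" by (simp add: defs \<alpha>\<beta>)
  show "\<not> large \<alpha> {0}" by (simp add: defs \<alpha>)
  show "\<not> large \<beta> {1, 2, 5}" by (simp add: defs \<beta>)
qed

end

theory Submission
  imports Defs "HOL-Library.Multiset"
begin

text \<open>
  Walking through \<open>X\<close>, a point of \<open>X\<^sub>0\<close> reduces the last term of \<open>\<alpha>\<close> and a point of \<open>X\<^sub>1\<close> that of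
  \<open>\<beta>\<close>. On \<open>\<alpha> \<oplus> \<beta>\<close> this is a play in which each point reduces some term, not necessarily the least
  one. Among all such plays, always reducing the least term is the slowest. So if it reaches \<open>0\<close>
  on \<open>X\<close>, every play does. Were both \<open>\<alpha>\<close> and \<open>\<beta>\<close> still nonzero just before the maximum of \<open>X\<close>,
  at least two terms would be left, which a single step cannot remove.
\<close>

section \<open>Elementary facts on normal forms\<close>

lemma Cnf_less_snoc_cases:
  assumes "Cnf es < Cnf (ds @ [g])"
  shows "Cnf es \<le> Cnf ds \<or> (\<exists>h hs. es = ds @ h # hs \<and> h < g)"
  using assms
proof (induction ds arbitrary: es)
  case Nil
  then show ?case by (cases es) auto
next
  case (Cons d ds)
  then show ?case by (cases es) (auto simp: le_less)
qed

definition cnf_suc :: "cnf \<Rightarrow> cnf" where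
  "cnf_suc t = Cnf (exps t @ [Cnf []])"

lemma less_cnf_suc_iff: "s < cnf_suc t \<longleftrightarrow> s \<le> t"
proof
  assume "s < cnf_suc t"
  then show "s \<le> t"
    using Cnf_less_snoc_cases[of "exps s" "exps t" "Cnf []"] by (simp add: cnf_suc_def)
next
  have "t < cnf_suc t"
    using Cnf_append_less_iff[of "exps t" "[]" "[Cnf []]"] by (simp add: cnf_suc_def)
  then show "s \<le> t \<Longrightarrow> s < cnf_suc t" by simp
qed

lemma nf_replicate: "nf t \<Longrightarrow> nf (Cnf (replicate n t))"
  by (auto simp: sorted_wrt_iff_nth_less)

definition cnf_limit :: "cnf \<Rightarrow> bool" where
  "cnf_limit t \<longleftrightarrow> exps t \<noteq> [] \<and> last (exps t) \<noteq> Cnf []"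

lemma cnf_cases [case_names zero suc limit]:
  obtains "t = Cnf []" | u where "t = cnf_suc u" | "cnf_limit t"
proof (cases "exps t = [] \<or> cnf_limit t")
  case True
  then show ?thesis using that by (cases t) auto
next
  case False
  then have "exps t = butlast (exps t) @ [Cnf []]"
    by (metis append_butlast_last_id cnf_limit_def)
  then have "t = cnf_suc (Cnf (butlast (exps t)))"
    unfolding cnf_suc_def by (metis cnf.collapse cnf.sel)
  then show ?thesis using that by blast
qed

lemma nf_cnf_suc_iff: "nf (cnf_suc t) \<longleftrightarrow> nf t"
  by (cases t) (auto simp: cnf_suc_def sorted_wrt_append)

lemma cnf_suc_less_limit:
  assumes "cnf_limit t" "s < t"
  shows "cnf_suc s < t"
proof -
  have "t \<noteq> cnf_suc s" using assms(1) by (auto simp: cnf_limit_def cnf_suc_def)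
  then show ?thesis using assms(2) less_cnf_suc_iff[of t s] by (auto simp: not_le[symmetric])
qed

text \<open>The number of occurrences of \<omega> in the fully expanded normal form. It is the norm
  that tells how large an argument suffices for a step to stay above a given ordinal.\<close>

fun nodes :: "cnf \<Rightarrow> nat" where
  "nodes (Cnf as) = (\<Sum>a\<leftarrow>as. Suc (nodes a))"

lemma nodes_cnf_suc: "nodes (cnf_suc t) = Suc (nodes t)"
  by (cases t) (simp add: cnf_suc_def)

lemma length_le_nodes: "length as \<le> nodes (Cnf as)"
  by (induction as) auto

lemma nodes_less: "a \<in> set as \<Longrightarrow> nodes a < nodes (Cnf as)"
  by (induction as) auto


section \<open>One step of the fundamental sequence\<close>

text \<open>Kept as a list of exponents, so that a step replaces the last exponent of a normal form
  by this list.\<close>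

definition omega_fund :: "cnf \<Rightarrow> nat \<Rightarrow> cnf list" where
  "omega_fund a x = exps (fund_cnf (Cnf [a]) x)"

lemma omega_fund_zero [simp]: "omega_fund (Cnf []) x = []"
  and omega_fund_suc [simp]: "omega_fund (cnf_suc a) x = replicate x a"
  and omega_fund_limit: "cnf_limit a \<Longrightarrow> omega_fund a x = [fund_cnf a x]"
  by (simp_all add: omega_fund_def cnf_suc_def cnf_limit_def fund_cnf.simps)

lemma fund_cnf_Nil [simp]: "fund_cnf (Cnf []) x = Cnf []"
  by (simp add: fund_cnf.simps)

lemma fund_cnf_snoc: "fund_cnf (Cnf (ds @ [a])) x = Cnf (ds @ omega_fund a x)"
  by (simp add: omega_fund_def fund_cnf.simps Let_def)

lemma fund_cnf_suc [simp]: "fund_cnf (cnf_suc t) x = t"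
  by (cases t) (simp add: cnf_suc_def fund_cnf_snoc)

lemma fund_cnf_append:
  "as \<noteq> [] \<Longrightarrow> fund_cnf (Cnf (ds @ as)) x = Cnf (ds @ exps (fund_cnf (Cnf as) x))"
  by (cases as rule: rev_cases) (simp_all add: fund_cnf_snoc flip: append_assoc)

lemma nf_omega_fund:
  assumes "nf a"
  shows "nf (Cnf (omega_fund a x))"
  unfolding omega_fund_def cnf.collapse using assms by (intro nf_fund_cnf) simp

lemma fund_cnf_le: "fund_cnf t x \<le> t"
  using fund_cnf_less[of t x] by (cases "t = Cnf []") auto

text \<open>For last exponent u + 1 and x > 0, at least one copy of \<omega>^u survives, with one
  node less; exponent 0 costs one node, and a limit exponent is handled by induction.\<close>

lemma nodes_fund_cnf: "0 < x \<Longrightarrow> nodes t \<le> Suc (nodes (fund_cnf t x))"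
proof (induction t)
  case (Cnf as)
  show ?case
  proof (cases as rule: rev_cases)
    case (snoc ds a)
    have "Suc (nodes a) \<le> Suc (nodes (Cnf (omega_fund a x)))"
    proof (cases a rule: cnf_cases)
      case (suc u)
      then show ?thesis using Cnf.prems by (cases x) (auto simp: nodes_cnf_suc)
    next
      case limit
      then show ?thesis using Cnf snoc by (simp add: omega_fund_limit)
    qed simp
    then show ?thesis by (simp add: snoc fund_cnf_snoc)
  qed simp
qed

text \<open>If s goes beyond the prefix \<open>ds\<close>, compare the next exponents h < g. For g =
  u + 1 the rest of s has fewer than z terms, all with exponent at most u, so it stays below z
  copies of \<omega>^u; for limit g, induction applies to h and g.\<close>

lemma limit_fund_dominates:
  assumes "cnf_limit t" "nf t" "nf s" "s < t" "nodes s < z"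
  shows "s < fund_cnf t z"
  using assms
proof (induction t arbitrary: s)
  case (Cnf as)
  then obtain ds g where as: "as = ds @ [g]" and g: "g \<noteq> Cnf []"
    by (cases as rule: rev_cases) (auto simp: cnf_limit_def)
  obtain es where s: "s = Cnf es" by (cases s)
  have ne: "omega_fund g z \<noteq> []"
    using g \<open>nodes s < z\<close> by (cases g rule: cnf_cases) (auto simp: omega_fund_limit)
  have "Cnf es \<le> Cnf ds \<or> (\<exists>h hs. es = ds @ h # hs \<and> h < g)"
    using Cnf_less_snoc_cases Cnf.prems as s by blast
  then show ?case
  proof
    assume "Cnf es \<le> Cnf ds"
    also have "\<dots> < Cnf (ds @ omega_fund g z)"
      using Cnf_append_less_iff[of ds "[]"] ne by (cases "omega_fund g z") auto
    finally show ?thesis by (simp add: as s fund_cnf_snoc)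
  next
    assume "\<exists>h hs. es = ds @ h # hs \<and> h < g"
    then obtain h hs where es: "es = ds @ h # hs" and h: "h < g" by blast
    have nh: "nf h" "nodes h < z" "length (h # hs) < z" "\<forall>h' \<in> set hs. h' \<le> h"
      using Cnf.prems nodes_less[of h es] length_le_nodes[of es] s es
      by (auto simp: sorted_wrt_append simp del: nodes.simps)
    have "Cnf (h # hs) < Cnf (omega_fund g z)"
    proof (cases g rule: cnf_cases)
      case (suc u)
      have *: "Cnf ks < Cnf (replicate n u)" if "\<forall>k \<in> set ks. k \<le> u" "length ks < n" for ks n
        using that
      proof (induction ks arbitrary: n)
        case (Cons k ks)
        then show ?case by (cases n) auto
      next
        case Nil
        then show ?case by (cases n) auto
      qed
      have "h \<le> u" using h suc less_cnf_suc_iff by simp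
      then have "\<forall>k \<in> set (h # hs). k \<le> u" using nh(4) by auto
      then show ?thesis using *[of "h # hs" z] nh(3) suc by simp
    next
      case limit
      then show ?thesis using Cnf.IH[of g h] Cnf.prems as h nh by (simp add: omega_fund_limit)
    qed (use g in simp)
    then show ?thesis by (simp add: as s es fund_cnf_snoc)
  qed
qed


section \<open>Iterating with a fixed argument\<close>

text \<open>The descent relation of Ketonen and Solovay, with the argument held fixed.\<close>

abbreviation reach :: "nat \<Rightarrow> cnf \<Rightarrow> cnf \<Rightarrow> bool" where
  "reach z \<equiv> (\<lambda>s t. t = fund_cnf s z)\<^sup>*\<^sup>*"

lemma reach_fund: "reach z t (fund_cnf t z)"
  by auto

lemma reach_le: "reach z s t \<Longrightarrow> t \<le> s"
  by (induction rule: rtranclp_induct) (auto intro: order_trans fund_cnf_le)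

lemma reach_nf: "reach z s t \<Longrightarrow> nf s \<Longrightarrow> nf t"
  by (induction rule: rtranclp_induct) (auto intro: nf_fund_cnf)

text \<open>The walk is deterministic and never increases, so it meets the larger of two of its
  ordinals first.\<close>

lemma reach_linear: "reach z s t \<Longrightarrow> reach z s u \<Longrightarrow> u \<le> t \<Longrightarrow> reach z t u"
proof (induction rule: converse_rtranclp_induct)
  case base
  then show ?case by simp
next
  case (step s s')
  show ?case
  proof (cases "s = u")
    case True
    then have "t = u"
      using reach_le[of z s t] step by (simp add: converse_rtranclp_into_rtranclp)
    then show ?thesis by simp
  next
    case False
    then have "reach z s' u" using step.prems(1) step.hyps(1) by (auto elim: converse_rtranclpE)
    then show ?thesis using step by blast
  qed
qed

lemma reach_append:
  assumes "reach z s t"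
  shows "reach z (Cnf (ds @ exps s)) (Cnf (ds @ exps t))"
  using assms
proof (induction rule: rtranclp_induct)
  case (step t u)
  have "reach z (Cnf (ds @ exps t)) (Cnf (ds @ exps u))"
    using step(2) fund_cnf_append[of "exps t" ds z] reach_fund[of z "Cnf (ds @ exps t)"]
    by (cases "exps t = []"; cases t) auto
  then show ?case using step.IH by simp
qed simp

lemma reach_zero: "nf t \<Longrightarrow> reach z t (Cnf [])"
proof -
  have "nf t \<longrightarrow> reach z t (Cnf [])" if "Wellfounded.accp nf_less t"
    using that
  proof (induction t rule: accp.induct)
    case (accI t)
    show ?case
    proof (cases "t = Cnf []")
      case False
      then show ?thesis
        using accI.IH[of "fund_cnf t z"] fund_cnf_less[OF False] nf_fund_cnf[of t z]
        by (auto intro: converse_rtranclp_into_rtranclp)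
    qed simp
  qed
  then show "nf t \<Longrightarrow> reach z t (Cnf [])" using accp_nf by blast
qed

lemma reach_drop: "nf (Cnf as) \<Longrightarrow> reach z (Cnf (ds @ as)) (Cnf ds)"
  using reach_append[OF reach_zero, of "Cnf as" z ds] by simp

lemma reach_replicate:
  assumes "nf t" "m \<le> n"
  shows "reach z (Cnf (replicate n t)) (Cnf (replicate m t))"
  using reach_drop[OF nf_replicate[OF assms(1)], of z "replicate m t" "n - m"] assms(2)
  by (simp flip: replicate_add)

text \<open>A step from exponent u + 1 to u produces z copies of \<omega>^u; as z > 0, one is kept
  and the others are run down to 0.\<close>

lemma reach_omega:
  assumes "reach z s t" "nf s" "0 < z"
  shows "reach z (Cnf [s]) (Cnf [t])"
  using assms(1)
proof (induction rule: rtranclp_induct)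
  case (step t u)
  have "nf t" using step(1) assms(2) reach_nf by blast
  have "reach z (Cnf [t]) (Cnf [u])"
  proof (cases t rule: cnf_cases)
    case zero
    then show ?thesis using step by simp
  next
    case (suc v)
    then have "reach z (Cnf [t]) (Cnf (replicate z u))"
      using step(2) fund_cnf_snoc[of "[]" t z] reach_fund[of z "Cnf [t]"] by simp
    moreover have "reach z (Cnf (replicate z u)) (Cnf (replicate 1 u))"
      using \<open>nf t\<close> step(2) nf_fund_cnf assms(3) by (intro reach_replicate) auto
    ultimately show ?thesis by simp
  next
    case limit
    then show ?thesis
      using step(2) fund_cnf_snoc[of "[]" t z] reach_fund[of z "Cnf [t]"]
      by (simp add: omega_fund_limit)
  qed
  then show ?case using step.IH by simp
qed simp

lemma reach_omega_append:
  assumes "reach z s t" "nf s" "0 < z"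
  shows "reach z (Cnf (ds @ [s])) (Cnf (ds @ [t]))"
  using reach_append[OF reach_omega[OF assms], of ds] by simp

lemma reach_omega_suc:
  assumes "nf t" "n \<le> z"
  shows "reach z (Cnf [cnf_suc t]) (Cnf (replicate n t))"
proof -
  have "reach z (Cnf [cnf_suc t]) (Cnf (replicate z t))"
    using reach_fund[of z "Cnf [cnf_suc t]"] fund_cnf_snoc[of "[]" "cnf_suc t" z] by simp
  also have "reach z (Cnf (replicate z t)) (Cnf (replicate n t))"
    using assms by (rule reach_replicate)
  finally show ?thesis .
qed

text \<open>For last exponent u + 1 there are at least x + 1 copies of \<omega>^u, and copy x + 1 is
  run down to \<omega>^0 = 1. For a limit g, induction leads to exponent {g}(x) + 1, whose term
  splits into two because z \<ge> 2; the second is run down to 1.\<close>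

lemma reach_limit_suc:
  assumes "cnf_limit t" "nf t" "0 < x" "x < z"
  shows "reach z (fund_cnf t z) (cnf_suc (fund_cnf t x))"
  using assms
proof (induction t)
  case (Cnf as)
  then obtain ds g where as: "as = ds @ [g]" and g: "g \<noteq> Cnf []"
    by (cases as rule: rev_cases) (auto simp: cnf_limit_def)
  have "nf g" using Cnf.prems as by simp
  have "reach z (Cnf (omega_fund g z)) (Cnf (omega_fund g x @ [Cnf []]))"
  proof (cases g rule: cnf_cases)
    case (suc u)
    then have u: "nf u" using \<open>nf g\<close> nf_cnf_suc_iff by simp
    have "reach z (Cnf (replicate z u)) (Cnf (replicate (Suc x) u))"
      using u Cnf.prems by (intro reach_replicate) auto
    moreover have "reach z (Cnf (replicate x u @ [u])) (Cnf (replicate x u @ [Cnf []]))"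
      using reach_omega_append reach_zero u Cnf.prems by simp
    ultimately show ?thesis by (simp add: suc replicate_append_same)
  next
    case limit
    let ?u = "fund_cnf g x"
    have u: "nf ?u" using \<open>nf g\<close> nf_fund_cnf by blast
    have "reach z (fund_cnf g z) (cnf_suc ?u)" using Cnf limit as by simp
    then have "reach z (Cnf [fund_cnf g z]) (Cnf [cnf_suc ?u])"
      using reach_omega \<open>nf g\<close> nf_fund_cnf Cnf.prems by simp
    also have "reach z (Cnf [cnf_suc ?u]) (Cnf ([?u] @ [?u]))"
      using reach_omega_suc[OF u, of 2 z] Cnf.prems by (simp add: numeral_eq_Suc)
    also have "reach z (Cnf ([?u] @ [?u])) (Cnf ([?u] @ [Cnf []]))"
      using Cnf.prems by (intro reach_omega_append reach_zero u) simp
    finally show ?thesis using limit by (simp add: omega_fund_limit)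
  qed (use g in simp)
  from reach_append[OF this, of ds] show ?case
    by (simp add: as fund_cnf_snoc cnf_suc_def)
qed

text \<open>In the limit case one more step at z removes the 1 provided by
  \<open>reach_limit_suc\<close>; otherwise the step is independent of the argument.\<close>

lemma reach_fund_mono:
  assumes "nf t" "0 < x" "x < z"
  shows "reach z (fund_cnf t z) (fund_cnf t x)"
proof (cases t rule: cnf_cases)
  case limit
  then show ?thesis
    using reach_limit_suc[OF _ assms] reach_fund[of z "cnf_suc (fund_cnf t x)"] by auto
qed auto

text \<open>The walk cannot jump over s: a successor goes to its predecessor, and a limit above s
  stays above s because the norm of s is below z.\<close>

lemma reach_of_nodes_less:
  assumes "nf s" "nf t" "s \<le> t" "nodes s < z"
  shows "reach z t s"
proof -
  have "nf t \<longrightarrow> s \<le> t \<longrightarrow> reach z t s" if "Wellfounded.accp nf_less t"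
    using that
  proof (induction t rule: accp.induct)
    case (accI t)
    show ?case
    proof (intro impI)
      assume t: "nf t" "s \<le> t"
      show "reach z t s"
      proof (cases "s = t")
        case False
        then have "s < t" using t by simp
        then have "t \<noteq> Cnf []" by auto
        have "s \<le> fund_cnf t z"
        proof (cases t rule: cnf_cases)
          case limit
          then show ?thesis using limit_fund_dominates assms t \<open>s < t\<close> by (simp add: less_imp_le)
        qed (use \<open>s < t\<close> less_cnf_suc_iff in auto)
        then show ?thesis
          using accI.IH[of "fund_cnf t z"] t nf_fund_cnf fund_cnf_less[OF \<open>t \<noteq> Cnf []\<close>]
          by (auto intro: converse_rtranclp_into_rtranclp)
      qed simp
    qed
  qed
  then show ?thesis using assms accp_nf by blast
qed


section \<open>Natural sums as multisets of exponents\<close>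

text \<open>In this form the natural sum is the union of multisets of exponents.\<close>

definition cnf_mset :: "cnf multiset \<Rightarrow> cnf" where
  "cnf_mset M = Cnf (rev (sorted_list_of_multiset M))"

lemma mset_exps_cnf_mset [simp]: "mset (exps (cnf_mset M)) = M"
  by (simp add: cnf_mset_def)

lemma cnf_mset_eq: "nf (Cnf as) \<Longrightarrow> cnf_mset (mset as) = Cnf as"
proof -
  assume "nf (Cnf as)"
  then have "sorted (rev as)" by (simp add: sorted_wrt_rev)
  then have "sort as = rev as" by (intro properties_for_sort) auto
  then show ?thesis by (simp add: cnf_mset_def)
qed

lemma nf_cnf_mset: "(\<And>a. a \<in># M \<Longrightarrow> nf a) \<Longrightarrow> nf (cnf_mset M)"
  by (simp add: cnf_mset_def sorted_wrt_rev)

lemma nf_in_exps: "nf t \<Longrightarrow> a \<in> set (exps t) \<Longrightarrow> nf a"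
  by (cases t) auto

text \<open>The larger argument z pays for the extra \<omega>^e. For c = u + 1 a spare copy of
  \<omega>^u descends to it; for limit c the exponent {c}(z) descends to the successor of the larger
  of e and {c}(x), whose term splits in two.\<close>

lemma reach_omega_fund_add:
  assumes "e < c" "nf e" "nf c" "0 < x" "x < z" "Suc (nodes e) < z"
  shows "reach z (Cnf (omega_fund c z)) (cnf_mset (add_mset e (mset (omega_fund c x))))"
proof (cases c rule: cnf_cases)
  case zero
  then show ?thesis using assms by simp
next
  case (suc u)
  then have u: "nf u" "e \<le> u" using assms nf_cnf_suc_iff less_cnf_suc_iff by auto
  have "reach z (Cnf (replicate z u)) (Cnf (replicate (Suc x) u))"
    using u assms by (intro reach_replicate) auto
  also have "replicate (Suc x) u = replicate x u @ [u]" by (simp add: replicate_append_same)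
  also have "reach z (Cnf (replicate x u @ [u])) (Cnf (replicate x u @ [e]))"
    using reach_omega_append[of z u e] reach_of_nodes_less[of e u z] u assms by simp
  also have "Cnf (replicate x u @ [e]) = cnf_mset (mset (replicate x u @ [e]))"
    using u assms nf_replicate[OF u(1), of x] by (intro cnf_mset_eq[symmetric])
      (auto simp: sorted_wrt_append)
  finally show ?thesis by (simp add: suc)
next
  case limit
  let ?d = "fund_cnf c z" and ?u = "fund_cnf c x"
  have nf: "nf ?d" "nf ?u" using assms nf_fund_cnf by auto
  have d_u: "reach z ?d (cnf_suc ?u)" using reach_limit_suc limit assms by simp
  have "cnf_suc e < ?d"
    using limit_fund_dominates[OF limit] cnf_suc_less_limit[OF limit] nf_cnf_suc_iff assms
    by (simp add: nodes_cnf_suc)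
  then have d_e: "reach z ?d (cnf_suc e)"
    using reach_of_nodes_less nf nf_cnf_suc_iff assms by (simp add: nodes_cnf_suc)
  have *: "reach z (Cnf [?d]) (cnf_mset {#a, b#})"
    if "reach z ?d (cnf_suc a)" "reach z a b" "nf a" for a b
  proof -
    have "reach z (Cnf [?d]) (Cnf [cnf_suc a])" using reach_omega that nf assms by simp
    also have "reach z (Cnf [cnf_suc a]) (Cnf ([a] @ [a]))"
      using reach_omega_suc[OF that(3), of 2 z] assms by (simp add: numeral_eq_Suc)
    also have "reach z (Cnf ([a] @ [a])) (Cnf ([a] @ [b]))"
      using assms by (intro reach_omega_append that) simp
    also have "Cnf ([a] @ [b]) = cnf_mset (mset ([a] @ [b]))"
      using reach_le that reach_nf by (intro cnf_mset_eq[symmetric]) auto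
    finally show ?thesis by (simp add: add_mset_commute)
  qed
  have "reach z (Cnf [?d]) (cnf_mset {#e, ?u#})"
  proof (cases "?u \<le> e")
    case True
    \<comment> \<open>The norm of \<open>?u\<close> is not bounded by z, so
      \<open>reach_of_nodes_less\<close> does not apply; instead both ordinals lie on one walk from
      \<open>?d\<close>.\<close>
    have "reach z ?d e" "reach z ?d ?u"
      using d_e d_u reach_fund[of z "cnf_suc e"] reach_fund[of z "cnf_suc ?u"] by auto
    then have "reach z e ?u" using True by (rule reach_linear)
    then show ?thesis using * d_e assms(2) by blast
  next
    case False
    then have "reach z ?u e" using reach_of_nodes_less nf assms by simp
    then show ?thesis using *[OF d_u _ nf(2), of e] by (simp add: add_mset_commute)
  qed
  then show ?thesis using limit by (simp add: omega_fund_limit)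
qed


section \<open>Killing an ordinal along a list\<close>

abbreviation kills :: "nat list \<Rightarrow> cnf \<Rightarrow> bool" where
  "kills xs t \<equiv> foldl fund_cnf t xs = Cnf []"

lemma kills_zero: "kills xs (Cnf [])"
  by (induction xs) auto

text \<open>By induction \<open>ys\<close> still kills after any further steps at the next point y,
  hence along the walk from {t}(y) to {t}(x); prepending y once more gives the claim.\<close>

lemma kills_Cons:
  assumes "nf t" "sorted_wrt (<) (x # xs)" "0 < x" "kills xs t"
  shows "kills (x # xs) t"
  using assms
proof (induction xs arbitrary: t x)
  case (Cons y ys)
  have *: "kills ys u" if "reach y s u" "nf s" "kills ys s" for s u
    using that
  proof (induction rule: rtranclp_induct)
    case (step u v)
    then show ?case using Cons.IH[of u y] Cons.prems reach_nf[of y s u] by auto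
  qed
  have "kills ys (fund_cnf t x)"
    using *[OF reach_fund_mono[of t x y]] Cons.prems nf_fund_cnf by simp
  then show ?case using Cons.IH[of "fund_cnf t x" y] Cons.prems nf_fund_cnf by simp
qed simp

lemma kills_append_left:
  assumes "nf t" "sorted_wrt (<) (ws @ xs)" "0 \<notin> set ws" "kills xs t"
  shows "kills (ws @ xs) t"
  using assms
proof (induction ws)
  case (Cons w ws)
  then show ?case using kills_Cons[of t w "ws @ xs"] by simp
qed simp

lemma nodes_le_length_of_kills:
  "kills xs t \<Longrightarrow> 0 \<notin> set xs \<Longrightarrow> nodes t \<le> length xs"
proof (induction xs arbitrary: t)
  case (Cons x xs)
  then show ?case using nodes_fund_cnf[of x t] by fastforce
qed simp

text \<open>Steps touch only the part after \<open>ds\<close> until it is exhausted; the points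
  spent on it form \<open>ws\<close>.\<close>

lemma kills_append_split:
  "kills xs (Cnf (ds @ es)) \<Longrightarrow> ds \<noteq> [] \<Longrightarrow>
    \<exists>ws zs. xs = ws @ zs \<and> kills ws (Cnf es) \<and> kills zs (Cnf ds)"
proof (induction xs arbitrary: es)
  case (Cons x xs)
  show ?case
  proof (cases "es = []")
    case True
    then show ?thesis using Cons.prems by (intro exI[of _ "[]"] exI[of _ "x # xs"]) simp
  next
    case False
    obtain ws zs where "xs = ws @ zs" "kills ws (fund_cnf (Cnf es) x)" "kills zs (Cnf ds)"
      using Cons.IH[of "exps (fund_cnf (Cnf es) x)"] Cons.prems fund_cnf_append[OF False] by auto
    then show ?thesis by (intro exI[of _ "x # ws"] exI[of _ zs]) simp
  qed
qed simp

lemma length_less_of_strict_sorted: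
  "sorted_wrt (<) (xs @ [y]) \<Longrightarrow> 0 \<notin> set (xs @ [y]) \<Longrightarrow> length xs < y" for y :: nat
proof (induction xs arbitrary: y rule: rev_induct)
  case (snoc x xs)
  then show ?case by (fastforce simp: sorted_wrt_append)
qed simp

text \<open>
  If the last term is \<open>\<omega>\<^bsup>e\<^esup>\<close> and \<open>c > e\<close> is chosen instead at \<open>x\<close>, wait until the rest of \<open>\<omega>\<^bsup>e\<^esup>\<close> is used up; the
  next point \<open>y\<close> then exceeds the size of \<open>e\<close>, so reducing \<open>\<omega>\<^bsup>c\<^esup>\<close> at \<open>y\<close> yields an ordinal from
  which the \<open>c\<close>-reduct at \<open>x\<close> together with \<open>\<omega>\<^bsup>e\<^esup>\<close> can still be reached.
\<close>

lemma kills_reduce_any_term: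
  assumes "sorted_wrt (<) (x # xs)" "0 < x" "nf t" "c \<in> set (exps t)" "kills (x # xs) t"
  shows "kills xs (cnf_mset (mset (exps t) - {#c#} + mset (omega_fund c x)))"
  using assms
proof (induction "length xs" arbitrary: x xs t c rule: less_induct)
  case less
  obtain ds e where t: "t = Cnf (ds @ [e])"
    using less.prems(4) by (cases t; cases "exps t" rule: rev_cases) auto
  have ds_e: "kills xs (Cnf (ds @ omega_fund e x))"
    using less.prems(5) by (simp add: t fund_cnf_snoc)
  show ?case
  proof (cases "c = e")
    case True
    have "nf (Cnf (ds @ omega_fund e x))"
      using nf_fund_cnf[OF less.prems(3), of x] by (simp add: t fund_cnf_snoc del: nf.simps)
    then show ?thesis using ds_e cnf_mset_eq[of "ds @ omega_fund e x"] by (simp add: t True)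
  next
    case False
    then have c: "c \<in> set ds" using less.prems(4) t by simp
    have nf: "nf (Cnf ds)" "nf e" "nf c" "e < c"
      using less.prems(3) False c by (auto simp: t sorted_wrt_append le_less)
    define M where "M = mset ds - {#c#}"
    have M: "mset ds = add_mset c M" using c by (simp add: M_def)
    have nf_M: "nf a" if "a \<in># M" for a
      using nf(1) that in_diffD[of a "mset ds"] by (auto simp: M_def)
    have nf_sum: "nf (cnf_mset (M + mset (exps s)))" if "nf s" for s
      using that nf_M nf_in_exps by (intro nf_cnf_mset) auto
    obtain ws zs where xs: "xs = ws @ zs" and ws: "kills ws (Cnf (omega_fund e x))"
      and zs: "kills zs (Cnf ds)"
      using kills_append_split[OF ds_e] c by fastforce
    obtain y zs' where zs': "zs = y # zs'" using zs c by (cases zs) auto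
    have sorted: "sorted_wrt (<) (y # zs')" "0 < y" "x < y" "0 \<notin> set (ws @ [y])"
      using less.prems(1,2) by (auto simp: xs zs' sorted_wrt_append)
    \<comment> \<open>These points use up \<omega>^e, each removing at most one node; being
      positive, increasing and below y, they are fewer than y.\<close>
    have "kills (x # ws) (Cnf [e])" using ws fund_cnf_snoc[of "[]" e x] by simp
    then have "nodes (Cnf [e]) \<le> length (x # ws)"
      using less.prems(2) sorted(4) by (intro nodes_le_length_of_kills) auto
    moreover have "length (x # ws) < y"
      using length_less_of_strict_sorted[of "x # ws" y] less.prems(1,2) sorted(4)
      by (auto simp: xs zs' sorted_wrt_append)
    ultimately have y: "Suc (nodes e) < y" by simp
    \<comment> \<open>The induction hypothesis for the shorter list \<open>zs'\<close>, with y as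
      the point at which a term is chosen freely.\<close>
    have any_term: "kills zs' (cnf_mset (M' - {#a#} + mset (omega_fund a y)))"
      if "nf (cnf_mset M')" "a \<in># M'" "kills (y # zs') (cnf_mset M')" for M' a
      using less.hyps[of zs' y "cnf_mset M'" a] that sorted
      by (simp add: xs zs' flip: set_mset_mset)
    have "kills zs' (cnf_mset (M + mset (exps (Cnf (omega_fund c y)))))"
      using any_term[of "mset ds" c] c nf cnf_mset_eq[OF nf(1)] zs
      by (simp add: M zs' del: nf.simps)
    \<comment> \<open>A walk at y may be run on one summand beside \<open>M\<close>:
      \<open>kills_Cons\<close> supplies a further y, and \<open>any_term\<close> spends it on the
      last term of \<open>u\<close>, which need not be least in the whole sum.\<close>
    moreover have kills_reach: "kills zs' (cnf_mset (M + mset (exps u)))"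
      if "reach y s u" "nf s" "kills zs' (cnf_mset (M + mset (exps s)))" for s u
      using that
    proof (induction rule: rtranclp_induct)
      case (step u v)
      show ?case
      proof (cases "exps u" rule: rev_cases)
        case Nil
        then have "v = u" using step(2) by (cases u) simp
        then show ?thesis using step by simp
      next
        case (snoc as a)
        then have v: "exps v = as @ omega_fund a y"
          using step(2) fund_cnf_snoc[of as a y] by (cases u) simp
        have "nf u" using step reach_nf by blast
        then have "kills (y # zs') (cnf_mset (M + mset (exps u)))"
          using kills_Cons nf_sum step sorted by blast
        then show ?thesis
          using any_term[of "M + mset (exps u)" a] nf_sum[OF \<open>nf u\<close>] snoc v
          by (simp add: ac_simps)
      qed
    qed
    ultimately have "kills zs' (cnf_mset (M + add_mset e (mset (omega_fund c x))))"
      using kills_reach[OF reach_omega_fund_add[of e c x y]] nf less.prems(2) sorted(3) y nf_omega_fund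
      by (simp del: nf.simps)
    moreover have "nf (cnf_mset (M + add_mset e (mset (omega_fund c x))))"
      using nf_M nf nf_omega_fund[of c x]
      by (intro nf_cnf_mset) auto
    \<comment> \<open>The points spent on \<omega>^e, and y itself, are put back in front.\<close>
    ultimately have "kills ((ws @ [y]) @ zs') (cnf_mset (M + add_mset e (mset (omega_fund c x))))"
      using less.prems(1) sorted(4) by (intro kills_append_left) (auto simp: xs zs')
    then show ?thesis using M by (simp add: t xs zs')
  qed
qed

text \<open>The last term of s is a term of the natural sum, though not necessarily its
  least.\<close>

lemma kills_natural_sum_step:
  assumes "sorted_wrt (<) (x # xs)" "0 < x" "nf s" "nf t" "s \<noteq> Cnf []"
    and "kills (x # xs) (cnf_mset (mset (exps s) + mset (exps t)))"
  shows "kills xs (cnf_mset (mset (exps (fund_cnf s x)) + mset (exps t)))"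
proof -
  obtain as a where s: "s = Cnf (as @ [a])"
    using assms(5) by (cases s; cases "exps s" rule: rev_cases) auto
  let ?M = "mset (exps s) + mset (exps t)"
  have "nf (cnf_mset ?M)" using assms(3,4) nf_in_exps by (intro nf_cnf_mset) auto
  moreover have "a \<in> set (exps (cnf_mset ?M))" by (simp add: s flip: set_mset_mset)
  ultimately show ?thesis
    using kills_reduce_any_term[OF assms(1,2) _ _ assms(6), of a]
    by (simp add: s fund_cnf_snoc ac_simps)
qed

text \<open>Each x reduces s if P x holds and t otherwise, until one of them is 0 or only z is
  left.\<close>

lemma kills_split:
  assumes "sorted_wrt (<) (xs @ [z])" "0 \<notin> set xs" "nf s" "nf t" "\<forall>x \<in> set xs. P x \<or> Q x"
    and "kills (xs @ [z]) (cnf_mset (mset (exps s) + mset (exps t)))"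
  shows "kills (filter P xs) s \<or> kills (filter Q xs) t"
  using assms
proof (induction xs arbitrary: s t)
  case Nil
  let ?as = "exps (cnf_mset (mset (exps s) + mset (exps t)))"
  have len: "length ?as = length (exps s) + length (exps t)"
    using mset_exps_cnf_mset by (metis size_mset size_union)
  \<comment> \<open>A step changes only the last term, so reaching 0 at z leaves room for one term
    in all; hence s or t is 0.\<close>
  have "length ?as \<le> 1"
  proof (cases ?as rule: rev_cases)
    case (snoc ds a)
    then have "cnf_mset (mset (exps s) + mset (exps t)) = Cnf (ds @ [a])"
      by (metis cnf.collapse)
    then show ?thesis using Nil.prems(6) by (simp add: fund_cnf_snoc)
  qed simp
  then show ?case using len by (cases s; cases t; cases "exps s"; cases "exps t") auto
next
  case (Cons x xs)
  have sorted: "sorted_wrt (<) (x # xs @ [z])" "0 < x" using Cons.prems by auto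
  \<comment> \<open>A point with both P and Q is spent on s alone; adding it to the list for t does
    no harm.\<close>
  have prepend: "kills (filter R (x # xs)) u"
    if "nf u" "kills (filter R xs) u" for R u
    using kills_Cons[of u x "filter R xs"] that Cons.prems
    by (auto simp: sorted_wrt_append sorted_wrt_filter)
  show ?case
  proof (cases "s = Cnf [] \<or> t = Cnf []")
    case True
    then show ?thesis using kills_zero by blast
  next
    case False
    show ?thesis
    proof (cases "P x")
      case True
      have "kills (filter P xs) (fund_cnf s x) \<or> kills (filter Q xs) t"
        using Cons.IH[of "fund_cnf s x" t] Cons.prems False nf_fund_cnf
          kills_natural_sum_step[OF sorted, of s t] by simp
      then show ?thesis using True prepend[of t Q] Cons.prems(4)
        by (metis filter.simps(2) foldl_Cons)
    next
      case notP: False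
      then have "Q x" using Cons.prems by simp
      have "kills (filter P xs) s \<or> kills (filter Q xs) (fund_cnf t x)"
        using Cons.IH[of s "fund_cnf t x"] Cons.prems False nf_fund_cnf
          kills_natural_sum_step[OF sorted, of t s] by (simp add: add.commute)
      then show ?thesis using \<open>Q x\<close> notP by auto
    qed
  qed
qed

lemma large_iff_kills:
  "large \<alpha> X \<longleftrightarrow> finite X \<and> kills (sorted_list_of_set X) (cnf_of \<alpha>)"
proof -
  have "cnf_of (foldl fund \<alpha> xs) = foldl fund_cnf (cnf_of \<alpha>) xs" for xs
    by (induction xs arbitrary: \<alpha>) (simp_all add: fund.rep_eq)
  then show ?thesis
    by (simp add: large_def fund_set_def cnf_of_inject[symmetric] zero_eps0.rep_eq)
qed

theorem mainTheorem6:
  fixes \<alpha> \<beta> :: eps0 and X\<^sub>0 X\<^sub>1 :: "nat set" and s :: nat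
  assumes "finite X\<^sub>0" and "finite X\<^sub>1"
    and "0 \<notin> X\<^sub>0 \<union> X\<^sub>1"
    and "\<forall>x \<in> X\<^sub>0 \<union> X\<^sub>1. x < s"
    and "large (\<alpha> \<oplus> \<beta>) (X\<^sub>0 \<union> X\<^sub>1 \<union> {s})"
  shows "large \<alpha> X\<^sub>0 \<or> large \<beta> X\<^sub>1"
proof -
  define xs where "xs = sorted_list_of_set (X\<^sub>0 \<union> X\<^sub>1)"
  have xs: "sorted_wrt (<) xs" "set xs = X\<^sub>0 \<union> X\<^sub>1"
    using assms(1,2) by (simp_all add: xs_def)
  have sorted: "sorted_wrt (<) (xs @ [s])"
    using xs assms(4) by (auto simp: sorted_wrt_append)
  have list_of: "sorted_list_of_set A = ys"
    if "sorted_wrt (<) ys" "set ys = A" for A and ys :: "nat list"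
    using that sorted_list_of_set.idem_if_sorted_distinct[of ys]
    by (auto simp: strict_sorted_iff)
  have filters: "filter (\<lambda>x. x \<in> X\<^sub>0) xs = sorted_list_of_set X\<^sub>0"
    "filter (\<lambda>x. x \<in> X\<^sub>1) xs = sorted_list_of_set X\<^sub>1"
    using xs by (auto intro!: list_of[symmetric] sorted_wrt_filter)
  have "sorted_list_of_set (X\<^sub>0 \<union> X\<^sub>1 \<union> {s}) = xs @ [s]"
    using list_of[OF sorted] xs by auto
  moreover have "cnf_of (\<alpha> \<oplus> \<beta>) = cnf_mset (mset (exps (cnf_of \<alpha>)) + mset (exps (cnf_of \<beta>)))"
    by (simp add: natural_sum.rep_eq cnf_mset_def flip: mset_append)
  ultimately have "kills (xs @ [s]) (cnf_mset (mset (exps (cnf_of \<alpha>)) + mset (exps (cnf_of \<beta>))))"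
    using assms(5) by (simp add: large_iff_kills)
  then have "kills (filter (\<lambda>x. x \<in> X\<^sub>0) xs) (cnf_of \<alpha>) \<or>
      kills (filter (\<lambda>x. x \<in> X\<^sub>1) xs) (cnf_of \<beta>)"
    using sorted xs assms(3) cnf_of by (intro kills_split) auto
  then show ?thesis using assms(1,2) by (simp add: large_iff_kills filters)
qed

end
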